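(* Given $p>1$, there exists a unique solution $U_+$ of the problem $$\begin{cases}-u''=xu-u^{p+1}, & x>0,\\ u(0)=0,\\ 0\leq u(x)\leq x^{1/p}, & x\geq0.\end{cases}$$ Furthermore, we have that $U_+'(x)>0$, $x\geq0$, and $$U_+(x)-x^{1/p}=\mathcal{O}\left(x^{\frac{1-3p}{p}}\right)\quad\text{as }x\to\infty.$$
   Context: Here $u$ and $U_+$ are real valued functions on $[0,\infty)$ and the prime denotes differentiation with respect to $x$.
   Formalization: The zero function satisfies the equation, u(0)=0 and 0 ≤ u ≤ x^{1/p}, so uniqueness fails as written; existence and uniqueness are stated among solutions that are not identically zero. *)

theory Defs
  imports "HOL-Analysis.Analysis" "HOL-Library.Landau_Symbols"
begin

text \<open>
  Functions on the half-line are total functions whose values at negative arguments are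
  irrelevant: at \<open>x > 0\<close> the term \<open>deriv u x\<close> only depends on \<open>u\<close> near \<open>x\<close>.
  Solutions are classical in the weakest sense: continuous on the closed half-line and twice
  differentiable on the open one (continuity of the second derivative follows from the equation).
  The sign condition makes \<open>powr\<close> the usual real power.
\<close>

definition is_solution :: "real \<Rightarrow> (real \<Rightarrow> real) \<Rightarrow> bool" where
  "is_solution p u \<longleftrightarrow>
     continuous_on {0..} u \<and>
     (\<forall>x>0. u field_differentiable (at x) \<and> deriv u field_differentiable (at x) \<and>
            - deriv (deriv u) x = x * u x - u x powr (p + 1)) \<and>
     u 0 = 0 \<and>
     (\<forall>x\<ge>0. 0 \<le> u x \<and> u x \<le> x powr (1 / p))"

text \<open>
  The zero function satisfies all conditions of \<open>is_solution\<close>, so uniqueness can only be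
  claimed among the solutions that do not vanish identically.
\<close>

definition is_nontrivial_solution :: "real \<Rightarrow> (real \<Rightarrow> real) \<Rightarrow> bool" where
  "is_nontrivial_solution p u \<longleftrightarrow> is_solution p u \<and> (\<exists>x\<ge>0. u x \<noteq> 0)"

end

theory Submission
  imports Defs
begin

text \<open>Existence is by shooting. Clipping \<open>u\<close> to \<open>[0, x powr (1 / p)]\<close> in the nonlinearity makes every
  trajectory concave and the initial value problem globally solvable, by a contraction in the norm
  with weight \<open>exp (p x\<^sup>2)\<close>. The slopes at \<open>0\<close> for which the trajectory decreases somewhere and those
  for which it exceeds \<open>x powr (1 / p)\<close> somewhere form disjoint open sets, both of which meet \<open>[1/3, 3]\<close>;
  any slope in between gives a solution. Uniqueness and the lower bound at infinity both follow
  from one Wronskian comparison of a solution with a subsolution: another solution on \<open>[0, \<infinity>)\<close>, and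
  \<open>x powr (1 / p) * (1 - 32 / x ^ 3)\<close> on \<open>[4, \<infinity>)\<close>.\<close>

section \<open>The clipped nonlinearity and its trajectories\<close>

definition clip :: "real \<Rightarrow> real \<Rightarrow> real \<Rightarrow> real" where
  "clip p t y = max 0 (min y (t powr (1 / p)))"

text \<open>Inside the strip \<open>0 \<le> y \<le> t powr (1 / p)\<close> this is the original
  nonlinearity \<open>t * y - y powr (p + 1)\<close>. It vanishes at both edges of the strip, so
  freezing it outside keeps it continuous and nonnegative and makes it globally Lipschitz in
  \<open>y\<close>.\<close>

definition damping :: "real \<Rightarrow> real \<Rightarrow> real \<Rightarrow> real" where
  "damping p t y = clip p t y * (t - clip p t y powr p)"

text \<open>The slope is a function of its own and derivatives are one-sided at \<open>0\<close>:
  the initial slope \<open>u' 0\<close> is the shooting parameter, while \<open>deriv u 0\<close>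
  would depend on values at negative arguments.\<close>

definition trajectory :: "real \<Rightarrow> (real \<Rightarrow> real) \<Rightarrow> (real \<Rightarrow> real) \<Rightarrow> bool" where
  "trajectory p u u' \<longleftrightarrow> u 0 = 0 \<and>
     (\<forall>x\<ge>0. (u has_real_derivative u' x) (at x within {0..}) \<and>
            (u' has_real_derivative - damping p x (u x)) (at x within {0..}))"

lemma mean_value:
  fixes f f' :: "real \<Rightarrow> real"
  assumes "a < b" "continuous_on {a..b} f"
    and f': "\<And>x. \<lbrakk>a < x; x < b\<rbrakk> \<Longrightarrow> (f has_real_derivative f' x) (at x)"
  obtains c where "a < c" "c < b" "f b - f a = (b - a) * f' c"
proof -
  obtain c where "c \<in> {a<..<b}" "f b - f a = f' c * (b - a)"
    using mvt[OF assms(1,2), of "\<lambda>x. (*) (f' x)"] f'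
    by (auto simp: has_field_derivative_def)
  with that show ?thesis by (auto simp: mult.commute)
qed

lemma le_powr_inverse_iff:
  fixes p x y :: real
  assumes "p > 1" "0 \<le> y" "0 \<le> x"
  shows "y \<le> x powr (1 / p) \<longleftrightarrow> y powr p \<le> x"
proof -
  have "(x powr (1 / p)) powr p = x"
    using assms by (simp add: powr_powr)
  then show ?thesis
    using assms powr_mono2[of p y "x powr (1/p)"] powr_less_mono2[of p "x powr (1/p)" y]
    by force
qed

lemma clip_nonneg: "0 \<le> clip p t y"
  by (simp add: clip_def)

lemma clip_le: "clip p t y \<le> t powr (1 / p)"
  by (simp add: clip_def)

lemma damping_nonneg:
  assumes "p > 1" "0 \<le> t"
  shows "0 \<le> damping p t y"
  using le_powr_inverse_iff[OF assms(1) clip_nonneg assms(2)] clip_le[of p t y]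
  by (simp add: damping_def clip_nonneg)

lemma damping_eq:
  assumes "0 \<le> y" "y \<le> t powr (1 / p)"
  shows "damping p t y = y * (t - y powr p)"
  using assms by (simp add: damping_def clip_def)

lemma damping_below: "y \<le> 0 \<Longrightarrow> damping p t y = 0"
  by (simp add: damping_def clip_def min.coboundedI1 max_absorb1)

lemma damping_above:
  assumes "p > 1" "0 \<le> t" "t powr (1 / p) \<le> y"
  shows "damping p t y = 0"
  using assms by (simp add: damping_def clip_def min_absorb2 powr_powr)

text \<open>In the strip \<open>0 \<le> c powr p \<le> t\<close>, so the derivative
  \<open>t - (p + 1) * c powr p\<close> of \<open>c * (t - c powr p)\<close> lies between
  \<open>- p * t\<close> and \<open>t\<close>. Clipping itself is 1-Lipschitz.\<close>

lemma damping_lipschitz: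
  assumes "p > 1" "0 \<le> t"
  shows "\<bar>damping p t y - damping p t z\<bar> \<le> p * t * \<bar>y - z\<bar>"
proof -
  let ?f = "\<lambda>c. c * (t - c powr p)"
  have lip: "\<bar>?f b - ?f a\<bar> \<le> p * t * (b - a)" if ab: "0 \<le> a" "a < b" "b \<le> t powr (1 / p)" for a b
  proof -
    have "continuous_on {a..b} ?f"
      using ab assms by (intro continuous_intros continuous_on_powr') auto
    moreover have "(?f has_real_derivative t - (p + 1) * c powr p) (at c)" if "a < c" for c
      using that ab assms by (auto intro!: derivative_eq_intros simp: powr_diff field_simps)
    ultimately obtain c where c: "a < c" "c < b" "?f b - ?f a = (b - a) * (t - (p + 1) * c powr p)"
      using mean_value[of a b ?f "\<lambda>c. t - (p + 1) * c powr p"] ab by blast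
    have "c powr p \<le> t"
      using c ab assms le_powr_inverse_iff[of p c t] by simp
    then have "(p + 1) * c powr p \<le> (p + 1) * t" "t \<le> p * t"
      using assms by (auto intro: mult_left_mono simp: mult_le_cancel_right1)
    moreover have "0 \<le> (p + 1) * c powr p"
      using assms by simp
    ultimately have "\<bar>t - (p + 1) * c powr p\<bar> \<le> p * t"
      by (auto simp: abs_le_iff algebra_simps)
    then show ?thesis
      using c ab by (simp add: abs_mult mult.commute mult_left_mono)
  qed
  have *: "\<bar>damping p t y - damping p t z\<bar> \<le> p * t * \<bar>clip p t y - clip p t z\<bar>"
  proof (cases "clip p t y" "clip p t z" rule: linorder_cases)
    case less
    then show ?thesis
      using lip[OF clip_nonneg less clip_le] by (simp add: damping_def abs_minus_commute)
  next
    case greater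
    then show ?thesis
      using lip[OF clip_nonneg greater clip_le] by (simp add: damping_def)
  qed (simp add: damping_def)
  have "\<bar>clip p t y - clip p t z\<bar> \<le> \<bar>y - z\<bar>"
    by (auto simp: clip_def max_def min_def)
  then have "p * t * \<bar>clip p t y - clip p t z\<bar> \<le> p * t * \<bar>y - z\<bar>"
    using assms by (intro mult_left_mono) auto
  with * show ?thesis by linarith
qed

lemma continuous_on_damping:
  assumes "p > 1" "continuous_on S f" "S \<subseteq> {0..}"
  shows "continuous_on S (\<lambda>t. damping p t (f t))"
  unfolding damping_def clip_def
  using assms by (intro continuous_intros continuous_on_powr') auto

section \<open>Global solvability of the initial value problem\<close>

lemma has_derivative_integral_half_line:
  fixes f :: "real \<Rightarrow> real"
  assumes f: "continuous_on {0..} f" and x: "0 \<le> x"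
  shows "((\<lambda>x. integral {0..x} f) has_real_derivative f x) (at x within {0..})"
proof -
  have "((\<lambda>x. integral {0..x} f) has_real_derivative f x) (at x within {0..x+1})"
    using x by (intro integral_has_real_derivative continuous_on_subset[OF f]) auto
  moreover have "at x within {0..x+1} = at x within {0..}"
    using x by (intro at_within_nhd[where S = "{..<x+1}"]) auto
  ultimately show ?thesis by simp
qed

lemma continuous_on_integral_half_line:
  fixes f :: "real \<Rightarrow> real"
  assumes "continuous_on {0..} f"
  shows "continuous_on {0..} (\<lambda>x. integral {0..x} f)"
  using has_derivative_integral_half_line[OF assms]
  by (intro DERIV_continuous_on) auto

lemma abs_integral_le_diff:
  fixes f F F' :: "real \<Rightarrow> real"
  assumes f: "continuous_on {0..} f" and x: "0 \<le> x"
    and F: "\<And>t. (F has_real_derivative F' t) (at t)"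
    and le: "\<And>t. 0 \<le> t \<Longrightarrow> \<bar>f t\<bar> \<le> F' t"
  shows "\<bar>integral {0..x} f\<bar> \<le> F x - F 0"
proof -
  have F': "(F' has_integral (F x - F 0)) {0..x}"
    using x F by (intro fundamental_theorem_of_calculus)
      (auto simp: has_real_derivative_iff_has_vector_derivative[symmetric] intro: DERIV_subset)
  have "norm (integral {0..x} f) \<le> integral {0..x} F'"
    using le has_integral_integrable[OF F'] integrable_continuous_real[OF continuous_on_subset[OF f]]
    by (intro integral_norm_bound_integral) auto
  then show ?thesis
    using F' by (simp add: integral_unique)
qed

text \<open>The majorant \<open>M / 2 * exp (p * t\<^sup>2)\<close> has a second derivative that
  dominates the assumed bound, so it suffices to integrate twice. The gain of \<open>1 / 2\<close>
  is what makes the integral operator a contraction in the weighted norm.\<close>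

lemma abs_double_integral_le:
  fixes f :: "real \<Rightarrow> real"
  assumes p: "p > 1" and f: "continuous_on {0..} f" and x: "0 \<le> x" and M: "0 \<le> M"
    and le: "\<And>t. 0 \<le> t \<Longrightarrow> \<bar>f t\<bar> \<le> p * t * (exp (p * t\<^sup>2) * M)"
  shows "\<bar>integral {0..x} (\<lambda>s. integral {0..s} f)\<bar> \<le> exp (p * x\<^sup>2) * (M / 2)"
proof -
  let ?E = "\<lambda>t. M / 2 * exp (p * t\<^sup>2)"
  let ?E' = "\<lambda>t. M * p * t * exp (p * t\<^sup>2)"
  let ?E'' = "\<lambda>t. (M * p + 2 * M * p\<^sup>2 * t\<^sup>2) * exp (p * t\<^sup>2)"
  have E: "(?E has_real_derivative ?E' t) (at t)" for t
    by (auto intro!: derivative_eq_intros simp: field_simps)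
  have E': "(?E' has_real_derivative ?E'' t) (at t)" for t
    by (auto intro!: derivative_eq_intros simp: field_simps power2_eq_square)
  have "\<bar>f t\<bar> \<le> ?E'' t" if "0 \<le> t" for t
  proof -
    \<comment> \<open>Completing the square:
      \<open>2 * t\<^sup>2 - t + 1 / 8 = 2 * (t - 1 / 4)\<^sup>2\<close>.\<close>
    have "t \<le> 1 + 2 * t\<^sup>2"
      using zero_le_power2[of "t - 1/4"] by (simp add: power2_eq_square algebra_simps)
    also have "\<dots> \<le> 1 + 2 * p * t\<^sup>2"
      using p by (simp add: mult_le_cancel_right1)
    finally have "t * (p * M * exp (p * t\<^sup>2)) \<le> (1 + 2 * p * t\<^sup>2) * (p * M * exp (p * t\<^sup>2))"
      using p M by (intro mult_right_mono) auto
    with le[OF that] show ?thesis by (simp add: algebra_simps power2_eq_square)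
  qed
  then have "\<bar>integral {0..s} f\<bar> \<le> ?E' s" if "0 \<le> s" for s
    using abs_integral_le_diff[OF f that E'] by simp
  then have "\<bar>integral {0..x} (\<lambda>s. integral {0..s} f)\<bar> \<le> ?E x - ?E 0"
    by (intro abs_integral_le_diff[OF continuous_on_integral_half_line[OF f] x E])
  with M show ?thesis by (simp add: mult.commute)
qed

text \<open>Writing a trajectory as \<open>E * \<phi>\<close> with \<open>\<phi>\<close> bounded and
  continuous turns the integral equation into a fixed point problem with contraction factor
  \<open>1 / 2\<close>. The same estimate with two different slopes gives Lipschitz dependence on
  the slope, locally uniformly in \<open>x\<close>.\<close>

lemma trajectory_exists:
  assumes p: "p > 1"
  obtains U U' where
    "\<And>a. trajectory p (U a) (U' a)" "\<And>a. U' a 0 = a"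
    "\<And>a b x. 0 \<le> x \<Longrightarrow> \<bar>U a x - U b x\<bar> \<le> 2 * exp (p * x\<^sup>2) * \<bar>a - b\<bar>"
proof -
  define E where "E = (\<lambda>x::real. exp (p * x\<^sup>2))"
  have E_pos: "E x > 0" for x
    by (simp add: E_def)
  have E_ge: "x \<le> E x" if "0 \<le> x" for x
  proof -
    have "x \<le> 1 + x\<^sup>2"
      using zero_le_power2[of "x - 1/2"] by (simp add: power2_eq_square algebra_simps)
    also have "\<dots> \<le> 1 + p * x\<^sup>2"
      using p by (simp add: mult_le_cancel_right1)
    also have "\<dots> \<le> E x"
      unfolding E_def by (rule exp_ge_add_one_self)
    finally show ?thesis .
  qed
  have cont_E: "continuous_on S E" for S
    unfolding E_def by (intro continuous_intros)
  define G where "G = (\<lambda>\<phi>::real \<Rightarrow>\<^sub>C real. \<lambda>t. damping p t (E t * \<phi> t))"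
  have cont_G: "continuous_on {0..} (G \<phi>)" for \<phi>
    unfolding G_def by (intro continuous_on_damping p continuous_intros cont_E) auto
  define Y where "Y = (\<lambda>a \<phi> x. a * x - integral {0..x} (\<lambda>s. integral {0..s} (G \<phi>)))"
  have cont_Y: "continuous_on {0..} (Y a \<phi>)" for a \<phi>
    unfolding Y_def by (intro continuous_intros continuous_on_integral_half_line cont_G)
  have Y_diff: "\<bar>Y a \<phi> x - Y b \<psi> x\<bar> \<le> E x * (\<bar>a - b\<bar> + dist \<phi> \<psi> / 2)" if x: "0 \<le> x" for a b \<phi> \<psi> x
  proof -
    let ?D = "\<lambda>t. G \<phi> t - G \<psi> t"
    have bound: "\<bar>?D t\<bar> \<le> p * t * (E t * dist \<phi> \<psi>)" if "0 \<le> t" for t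
    proof -
      have "\<bar>?D t\<bar> \<le> p * t * \<bar>E t * \<phi> t - E t * \<psi> t\<bar>"
        unfolding G_def by (rule damping_lipschitz[OF p that])
      also have "\<bar>E t * \<phi> t - E t * \<psi> t\<bar> = E t * dist (\<phi> t) (\<psi> t)"
        using E_pos[of t] by (simp add: dist_real_def abs_mult flip: right_diff_distrib)
      also have "p * t * (E t * dist (\<phi> t) (\<psi> t)) \<le> p * t * (E t * dist \<phi> \<psi>)"
        using p that E_pos[of t] by (intro mult_left_mono dist_bounded) auto
      finally show ?thesis .
    qed
    have int_G: "G \<phi> integrable_on {0..s}" for \<phi> s
      by (intro integrable_continuous_real continuous_on_subset[OF cont_G]) auto
    have int_IG: "(\<lambda>s. integral {0..s} (G \<phi>)) integrable_on {0..x}" for \<phi>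
      by (intro integrable_continuous_real
          continuous_on_subset[OF continuous_on_integral_half_line[OF cont_G]]) auto
    have "integral {0..x} (\<lambda>s. integral {0..s} ?D) =
        integral {0..x} (\<lambda>s. integral {0..s} (G \<phi>)) - integral {0..x} (\<lambda>s. integral {0..s} (G \<psi>))"
      by (simp add: integral_diff int_G int_IG)
    then have "Y a \<phi> x - Y b \<psi> x = (a - b) * x - integral {0..x} (\<lambda>s. integral {0..s} ?D)"
      by (simp add: Y_def algebra_simps)
    moreover have "\<bar>integral {0..x} (\<lambda>s. integral {0..s} ?D)\<bar> \<le> E x * (dist \<phi> \<psi> / 2)"
      using bound unfolding E_def
      by (intro abs_double_integral_le p x continuous_intros cont_G) auto
    moreover have "\<bar>(a - b) * x\<bar> \<le> \<bar>a - b\<bar> * E x"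
      using x E_ge[OF x] by (simp add: abs_mult mult_left_mono)
    ultimately show ?thesis
      by (simp add: algebra_simps)
  qed
  \<comment> \<open>Comparison with this zero trajectory bounds \<open>T a \<phi>\<close>, so that
    \<open>T a\<close> maps bounded continuous functions to bounded continuous functions.\<close>
  have Y_zero: "Y 0 0 x = 0" if "0 \<le> x" for x
  proof -
    have "integral {0..x} (\<lambda>s. integral {0..s} (G 0)) = 0"
      by (simp add: G_def damping_below)
    then show ?thesis by (simp add: Y_def)
  qed
  \<comment> \<open>Bounded continuous functions live on the whole line here. \<open>max 0 x\<close>
    extends the values constantly to the left, which is harmless because the integrals only read
    arguments in the half-line.\<close>
  define T where "T = (\<lambda>a \<phi> x. Y a \<phi> (max 0 x) / E (max 0 x))"
  have T_diff: "\<bar>T a \<phi> x - T b \<psi> x\<bar> \<le> \<bar>a - b\<bar> + dist \<phi> \<psi> / 2" for a b \<phi> \<psi> x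
    using Y_diff[of "max 0 x" a \<phi> b \<psi>] E_pos[of "max 0 x"]
    by (simp add: T_def field_simps flip: diff_divide_distrib)
  have "T a \<phi> \<in> bcontfun" for a \<phi>
  proof (rule bcontfun_normI)
    have "continuous_on UNIV (\<lambda>x. Y a \<phi> (max 0 x))"
      by (rule continuous_on_compose2[OF cont_Y]) (auto intro!: continuous_intros)
    moreover have "continuous_on UNIV (\<lambda>x. E (max 0 x))"
      by (rule continuous_on_compose2[OF cont_E[of UNIV]]) (auto intro!: continuous_intros)
    ultimately show "continuous_on UNIV (T a \<phi>)"
      unfolding T_def using E_pos by (intro continuous_intros) (auto simp: less_imp_neq[symmetric])
    show "norm (T a \<phi> x) \<le> \<bar>a\<bar> + dist \<phi> 0 / 2" for x
      using T_diff[of a \<phi> x 0 0] Y_zero[of "max 0 x"] by (simp add: T_def)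
  qed
  then have apply_T: "apply_bcontfun (Bcontfun (T a \<phi>)) = T a \<phi>" for a \<phi>
    by (simp add: Bcontfun_inverse)
  have dist_T: "dist (Bcontfun (T a \<phi>)) (Bcontfun (T b \<psi>)) \<le> \<bar>a - b\<bar> + dist \<phi> \<psi> / 2" for a b \<phi> \<psi>
    using T_diff by (intro dist_bound) (simp add: apply_T dist_real_def)
  have "\<exists>!\<phi>. Bcontfun (T a \<phi>) = \<phi>" for a
    using dist_T[of a _ a] by (intro banach_fix_type[of "1/2"]) auto
  then obtain \<Phi> where \<Phi>: "\<And>a. Bcontfun (T a (\<Phi> a)) = \<Phi> a"
    by metis
  define U where "U = (\<lambda>a. Y a (\<Phi> a))"
  define U' where "U' = (\<lambda>a x. a - integral {0..x} (G (\<Phi> a)))"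
  have U_eq: "E x * \<Phi> a x = U a x" if "0 \<le> x" for a x
  proof -
    have "\<Phi> a x = T a (\<Phi> a) x"
      by (metis \<Phi> apply_T)
    then show ?thesis
      using that E_pos[of x] by (simp add: T_def U_def)
  qed
  have "trajectory p (U a) (U' a)" for a
    unfolding trajectory_def
  proof (intro conjI allI impI)
    show "U a 0 = 0"
      by (simp add: U_def Y_def)
    fix x :: real assume x: "0 \<le> x"
    show "(U a has_real_derivative U' a x) (at x within {0..})"
      unfolding U_def U'_def Y_def
      by (auto intro!: derivative_eq_intros has_derivative_integral_half_line
          continuous_on_integral_half_line cont_G x)
    have "(U' a has_real_derivative 0 - G (\<Phi> a) x) (at x within {0..})"
      unfolding U'_def
      by (intro derivative_intros has_derivative_integral_half_line cont_G x)
    then show "(U' a has_real_derivative - damping p x (U a x)) (at x within {0..})"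
      by (simp add: G_def U_eq[OF x])
  qed
  moreover have "U' a 0 = a" for a
    by (simp add: U'_def)
  moreover have "\<bar>U a x - U b x\<bar> \<le> 2 * exp (p * x\<^sup>2) * \<bar>a - b\<bar>" if x: "0 \<le> x" for a b x
  proof -
    \<comment> \<open>At the fixed points the distance occurs on both sides, with factor
      \<open>1 / 2\<close> on the right; absorbing it yields the factor \<open>2\<close>.\<close>
    have "dist (\<Phi> a) (\<Phi> b) \<le> 2 * \<bar>a - b\<bar>"
      using dist_T[of a "\<Phi> a" b "\<Phi> b"] by (simp add: \<Phi>)
    then have "E x * (\<bar>a - b\<bar> + dist (\<Phi> a) (\<Phi> b) / 2) \<le> E x * (2 * \<bar>a - b\<bar>)"
      using E_pos[of x] by simp
    with Y_diff[OF x, of a "\<Phi> a" b "\<Phi> b"]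
    have "\<bar>U a x - U b x\<bar> \<le> E x * (2 * \<bar>a - b\<bar>)"
      unfolding U_def by (rule order_trans)
    then show ?thesis
      by (simp add: E_def mult_ac)
  qed
  ultimately show thesis
    by (rule that)
qed

section \<open>Concavity, positivity and growth of trajectories\<close>

lemma at_within_half_line:
  fixes x :: real
  assumes "a < x"
  shows "at x within {a..} = at x"
  using assms by (intro at_within_interior) auto

lemma trajectory_derivs:
  assumes "trajectory p u u'" "0 \<le> x"
  shows "(u has_real_derivative u' x) (at x within {0..})"
    and "(u' has_real_derivative - damping p x (u x)) (at x within {0..})"
  using assms by (auto simp: trajectory_def)

lemma trajectory_derivs_at:
  assumes "trajectory p u u'" "0 < x"
  shows "(u has_real_derivative u' x) (at x)"
    and "(u' has_real_derivative - damping p x (u x)) (at x)"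
  using trajectory_derivs[OF assms(1), of x] assms(2) by (auto simp: at_within_half_line)

lemma trajectory_continuous:
  assumes "trajectory p u u'"
  shows "continuous_on {0..} u" "continuous_on {0..} u'"
  using trajectory_derivs[OF assms] by (intro DERIV_continuous_on; auto)+

lemma trajectory_mean_value:
  assumes u: "trajectory p u u'" and "0 \<le> a" "a < b"
  obtains c where "a < c" "c < b" "u b - u a = (b - a) * u' c"
proof (rule mean_value[OF \<open>a < b\<close>])
  show "continuous_on {a..b} u"
    using assms by (intro continuous_on_subset[OF trajectory_continuous(1)[OF u]]) auto
  show "(u has_real_derivative u' x) (at x)" if "a < x" for x
    using that assms by (intro trajectory_derivs_at[OF u]) auto
qed (rule that)

lemma trajectory_mean_value':
  assumes u: "trajectory p u u'" and "0 \<le> a" "a < b"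
  obtains c where "a < c" "c < b" "u' b - u' a = (b - a) * - damping p c (u c)"
proof (rule mean_value[OF \<open>a < b\<close>])
  show "continuous_on {a..b} u'"
    using assms by (intro continuous_on_subset[OF trajectory_continuous(2)[OF u]]) auto
  show "(u' has_real_derivative - damping p x (u x)) (at x)" if "a < x" for x
    using that assms by (intro trajectory_derivs_at[OF u]) auto
qed (rule that)

lemma trajectory_concave:
  assumes "p > 1" "trajectory p u u'" "0 \<le> a" "a \<le> b"
  shows "u' b \<le> u' a"
proof (cases "a < b")
  case True
  obtain c where c: "a < c" "c < b" "u' b - u' a = (b - a) * - damping p c (u c)"
    using trajectory_mean_value'[OF assms(2,3) True] .
  moreover have "0 \<le> (b - a) * damping p c (u c)"
    using c assms damping_nonneg[of p c] by auto
  ultimately show ?thesis by simp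
qed (use assms in auto)

lemma trajectory_increment:
  assumes "p > 1" "trajectory p u u'" "0 \<le> a" "a \<le> b"
  shows "(b - a) * u' b \<le> u b - u a" "u b - u a \<le> (b - a) * u' a"
proof -
  have "(b - a) * u' b \<le> u b - u a \<and> u b - u a \<le> (b - a) * u' a"
  proof (cases "a < b")
    case True
    obtain c where c: "a < c" "c < b" "u b - u a = (b - a) * u' c"
      using trajectory_mean_value[OF assms(2,3) True] .
    moreover have "u' b \<le> u' c" "u' c \<le> u' a"
      using c assms trajectory_concave[OF assms(1,2)] by auto
    ultimately show ?thesis
      using True by simp
  qed (use assms in auto)
  then show "(b - a) * u' b \<le> u b - u a" "u b - u a \<le> (b - a) * u' a" by auto
qed

lemma trajectory_mono:
  assumes "p > 1" "trajectory p u u'" "0 \<le> x" "x \<le> y" "0 \<le> u' y"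
  shows "u x \<le> u y"
proof -
  have "0 \<le> (y - x) * u' y"
    using assms by auto
  with trajectory_increment(1)[OF assms(1-4)] show ?thesis by linarith
qed

text \<open>If \<open>u b \<le> 0\<close>, monotonicity keeps \<open>u \<le> 0\<close> on
  \<open>[0, b]\<close>, where the damping vanishes. The slope at the mean value point
  \<open>c\<close> is then still \<open>u' 0 > 0\<close>, while \<open>u b = b * u' c\<close> makes
  it nonpositive.\<close>

lemma trajectory_pos:
  assumes "p > 1" "trajectory p u u'" "0 < u' 0" "0 < b" "0 \<le> u' b"
  shows "0 < u b"
proof (rule ccontr)
  assume neg: "\<not> 0 < u b"
  obtain c where c: "0 < c" "c < b" "u b - u 0 = (b - 0) * u' c"
    using trajectory_mean_value[OF assms(2), of 0 b] assms by auto
  obtain d where d: "0 < d" "d < c" "u' c - u' 0 = (c - 0) * - damping p d (u d)"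
    using trajectory_mean_value'[OF assms(2), of 0 c] c by auto
  have "u d \<le> u b"
    using c d assms by (intro trajectory_mono[OF assms(1,2)]) auto
  then have "u' c = u' 0"
    using d neg by (simp add: damping_below)
  then show False
    using c neg assms by (simp add: trajectory_def zero_less_mult_iff)
qed

text \<open>On \<open>[a, b]\<close> a violation would give \<open>- u'' > u a / (a (b - a))\<close>, hence \<open>u' a > u a / a\<close>,
  which contradicts concavity and \<open>u 0 = 0\<close>.\<close>
lemma trajectory_growth:
  assumes p: "p > 1" and u: "trajectory p u u'" and "0 < u' 0" and ab: "0 < a" "a < b" and "0 \<le> u' b"
  shows "a - 1 / (a * (b - a)) \<le> u b powr p"
proof (rule ccontr)
  assume neg: "\<not> a - 1 / (a * (b - a)) \<le> u b powr p"
  obtain c where c: "a < c" "c < b" "u' b - u' a = (b - a) * - damping p c (u c)"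
    using trajectory_mean_value'[OF u, of a b] ab by auto
  have "0 \<le> u' a"
    using trajectory_concave[OF p u, of a b] ab \<open>0 \<le> u' b\<close> by auto
  then have ua: "0 < u a"
    using trajectory_pos[OF p u] assms by auto
  have "0 \<le> u' c"
    using trajectory_concave[OF p u, of c b] ab c \<open>0 \<le> u' b\<close> by auto
  then have uac: "u a \<le> u c" and ucb: "u c \<le> u b"
    using c ab \<open>0 \<le> u' b\<close> trajectory_mono[OF p u, of a c] trajectory_mono[OF p u, of c b] by auto
  \<comment> \<open>Monotonicity transfers the supposed deficit at \<open>b\<close> to the inner
    point \<open>c\<close>, where the curvature is evaluated.\<close>
  have "u c powr p \<le> u b powr p"
    using p ua uac ucb by (intro powr_mono2) auto
  with neg c have gap: "1 / (a * (b - a)) < c - u c powr p"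
    by linarith
  have "0 < 1 / (a * (b - a))"
    using ab by simp
  then have "u c powr p \<le> c"
    using gap by linarith
  then have "u c \<le> c powr (1 / p)"
    using p ua uac ab c by (subst le_powr_inverse_iff) auto
  then have "damping p c (u c) = u c * (c - u c powr p)"
    using ua uac by (intro damping_eq) auto
  also have "\<dots> > u a * (1 / (a * (b - a)))"
    using ua uac gap \<open>0 < 1 / (a * (b - a))\<close> by (intro mult_le_less_imp_less) auto
  finally have "(b - a) * (u a * (1 / (a * (b - a)))) < (b - a) * damping p c (u c)"
    using ab by (intro mult_strict_left_mono) auto
  moreover have "(b - a) * (u a * (1 / (a * (b - a)))) = u a / a"
    using ab by (simp add: divide_simps)
  ultimately have "u a / a < u' a"
    using c \<open>0 \<le> u' b\<close> by simp
  moreover have "a * u' a \<le> u a"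
    using trajectory_increment(1)[OF p u, of 0 a] ab u by (auto simp: trajectory_def)
  ultimately show False
    using ab by (simp add: field_simps)
qed

section \<open>The Wronskian comparison\<close>

text \<open>Continuity induction: at a first point \<open>m\<close> with \<open>D m \<le> 0\<close>
  the hypothesis \<open>step\<close> would give \<open>D m \<ge> D c > 0\<close>. Applications may
  thus assume positivity before \<open>y\<close> when they prove growth up to
  \<open>y\<close>.\<close>

lemma positive_persists:
  fixes D :: "real \<Rightarrow> real"
  assumes cont: "continuous_on {c..d} D" and "0 < D c"
    and step: "\<And>y. \<lbrakk>c < y; y \<le> d; \<And>t. \<lbrakk>c \<le> t; t < y\<rbrakk> \<Longrightarrow> 0 < D t\<rbrakk> \<Longrightarrow> D c \<le> D y"
    and y: "c \<le> y" "y \<le> d"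
  shows "D c \<le> D y"
proof -
  let ?S = "{t \<in> {c..d}. D t \<le> 0}"
  have "?S = {}"
  proof (rule ccontr)
    assume ne: "?S \<noteq> {}"
    have "closed ?S"
      by (intro continuous_on_closed_Collect_le cont continuous_intros)
    then have "compact ?S"
      by (intro compact_eq_bounded_closed[THEN iffD2] conjI bounded_subset[OF bounded_closed_interval]) auto
    then obtain m where m: "m \<in> ?S" "\<And>t. t \<in> ?S \<Longrightarrow> m \<le> t"
      using compact_attains_inf[OF _ ne] by blast
    then have "c < m"
      using \<open>0 < D c\<close> by (cases "m = c") auto
    moreover have "0 < D t" if "c \<le> t" "t < m" for t
      using m(2)[of t] that m(1) by force
    ultimately have "D c \<le> D m"
      using step m by auto
    with m \<open>0 < D c\<close> show False by auto
  qed
  then have "0 < D t" if "c \<le> t" "t \<le> d" for t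
    using that by force
  with step[of y] y show ?thesis
    by (cases "c = y") auto
qed

text \<open>The Wronskian \<open>W = u z' - z u'\<close> is increasing where \<open>z > u\<close>, and \<open>(z / u)' = W / u\<^sup>2\<close>.
  Hence once \<open>z / u > 1\<close> it can never come back to \<open>1\<close>, so that \<open>u \<le> z / k\<close> with \<open>k > 1\<close>
  from some point on. This contradicts the growth of \<open>u\<close>.\<close>
lemma trajectory_comparison:
  fixes z z' z'' :: "real \<Rightarrow> real"
  assumes p: "p > 1" and u: "trajectory p u u'" and "0 < u' 0"
    and u'_nonneg: "\<And>x. 0 \<le> x \<Longrightarrow> 0 \<le> u' x" and u_le: "\<And>x. 0 \<le> x \<Longrightarrow> u x \<le> x powr (1 / p)"
    and a: "0 \<le> a"
    and z: "\<And>x. a \<le> x \<Longrightarrow> (z has_real_derivative z' x) (at x within {a..})"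
    and z': "\<And>x. a \<le> x \<Longrightarrow> (z' has_real_derivative z'' x) (at x within {a..})"
    and z_le: "\<And>x. a \<le> x \<Longrightarrow> z x \<le> x powr (1 / p)"
    and sub: "\<And>x. \<lbrakk>a < x; u x < z x\<rbrakk> \<Longrightarrow> - (z x * (x - z x powr p)) \<le> z'' x"
    and za: "z a \<le> u a" and x: "a \<le> x"
  shows "z x \<le> u x"
proof (rule ccontr)
  assume "\<not> z x \<le> u x"
  then have zx: "u x < z x" by simp
  have ax: "a < x"
    using zx za x by (cases "a = x") auto
  have u_pos: "0 < u t" if "0 < t" for t
    using that u'_nonneg by (intro trajectory_pos[OF p u \<open>0 < u' 0\<close>]) auto
  define W where "W = (\<lambda>t. u t * z' t - z t * u' t)"
  define r where "r = (\<lambda>t. z t / u t)"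
  have z_at: "(z has_real_derivative z' t) (at t)" "(z' has_real_derivative z'' t) (at t)" if "a < t" for t
    using z[of t] z'[of t] that by (auto simp: at_within_half_line)
  have u_at: "(u has_real_derivative u' t) (at t)"
    "(u' has_real_derivative - (u t * (t - u t powr p))) (at t)" if "a < t" for t
    using trajectory_derivs_at[OF u, of t] damping_eq[of "u t" t p] u_le[of t] u_pos[of t] that a
    by auto
  have W_at: "(W has_real_derivative u t * z'' t + z t * (u t * (t - u t powr p))) (at t)" if "a < t" for t
    unfolding W_def using that
    by (auto intro!: derivative_eq_intros z_at u_at simp: algebra_simps)
  \<comment> \<open>The subsolution inequality gives
    \<open>W' \<ge> u * z * (z powr p - u powr p)\<close>, which is positive where
    \<open>z > u > 0\<close>.\<close>
  have W_deriv_pos: "0 < u t * z'' t + z t * (u t * (t - u t powr p))" if "a < t" "u t < z t" for t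
  proof -
    have "0 < u t" using that a u_pos by auto
    then have "u t powr p < z t powr p"
      using that p by (intro powr_less_mono2) auto
    then have "0 < u t * z t * (z t powr p - u t powr p)"
      using \<open>0 < u t\<close> that by simp
    moreover have "u t * - (z t * (t - z t powr p)) \<le> u t * z'' t"
      using \<open>0 < u t\<close> sub[OF that] by (intro mult_left_mono) auto
    ultimately show ?thesis by (simp add: algebra_simps)
  qed
  have cont_z: "continuous_on {a..} z" "continuous_on {a..} z'"
    using z z' by (auto intro: DERIV_continuous_on)
  have cont_u: "continuous_on {a..} u" "continuous_on {a..} u'"
    using a by (auto intro: continuous_on_subset[OF trajectory_continuous(1)[OF u]]
        continuous_on_subset[OF trajectory_continuous(2)[OF u]])
  have cont_W: "continuous_on {a..} W"
    unfolding W_def by (intro continuous_intros cont_z cont_u)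
  have r_at: "(r has_real_derivative W t / (u t)\<^sup>2) (at t)" if "a < t" for t
    unfolding r_def W_def using that u_pos[of t] a
    by (auto intro!: derivative_eq_intros z_at u_at simp: power2_eq_square field_simps)
  have cont_r: "continuous_on {s..t} r" if "a < s" for s t
    using that by (intro DERIV_continuous_on[OF has_field_derivative_at_within[OF r_at]]) auto
  have r_gt: "1 < r t \<longleftrightarrow> u t < z t" if "a < t" for t
    using u_pos[of t] that a by (simp add: r_def field_simps)
  have W_mono: "W s < W t" if "a \<le> s" "s < t" and gt: "\<And>y. \<lbrakk>s < y; y < t\<rbrakk> \<Longrightarrow> 1 < r y" for s t
  proof (rule DERIV_pos_imp_increasing_open[OF \<open>s < t\<close>])
    show "\<exists>d. (W has_real_derivative d) (at y) \<and> 0 < d" if "s < y" "y < t" for y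
      using W_at[of y] W_deriv_pos[of y] gt[OF that] r_gt[of y] that \<open>a \<le> s\<close> by auto
    show "continuous_on {s..t} W"
      using \<open>a \<le> s\<close> by (intro continuous_on_subset[OF cont_W]) auto
  qed
  \<comment> \<open>Otherwise \<open>W \<le> 0\<close> wherever \<open>r > 1\<close>, so
    \<open>r\<close> stays at least \<open>r x > 1\<close> when followed back from \<open>x\<close>
    towards \<open>a\<close>. For \<open>a > 0\<close> this contradicts
    \<open>z a \<le> u a\<close>. For \<open>a = 0\<close> one has
    \<open>W 0 = - z 0 * u' 0 \<ge> 0\<close>, and \<open>W\<close> strictly increases up to
    \<open>x\<close>, so \<open>W x > 0\<close>, again a contradiction.\<close>
  obtain c where c: "a < c" "1 < r c" "0 < W c"
  proof (rule ccontr)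
    assume "\<not> thesis"
    with that have W_le: "W t \<le> 0" if "a < t" "1 < r t" for t
      using that by force
    have r_ge: "r x \<le> r s" if s: "a < s" "s \<le> x" for s
    proof -
      \<comment> \<open>Persistence of positivity runs to the right; the reflection
        \<open>t \<mapsto> - t\<close> makes it run from \<open>x\<close> back to
        \<open>s\<close>.\<close>
      have "r (- (- x)) - 1 \<le> r (- (- s)) - 1"
      proof (rule positive_persists[where D = "\<lambda>t. r (- t) - 1" and c = "- x" and d = "- s"])
        show "continuous_on {- x..- s} (\<lambda>t. r (- t) - 1)"
          by (intro continuous_intros continuous_on_compose2[OF cont_r[OF s(1), of x]]) auto
        fix y assume y: "- x < y" "y \<le> - s" and pos: "\<And>t. \<lbrakk>- x \<le> t; t < y\<rbrakk> \<Longrightarrow> 0 < r (- t) - 1"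
        have "r x \<le> r (- y)"
        proof (rule DERIV_nonpos_imp_decreasing_open[where a = "- y" and b = x and f = r])
          show "continuous_on {- y..x} r"
            using y s by (intro cont_r) auto
          show "\<exists>d. (r has_real_derivative d) (at t) \<and> d \<le> 0" if "- y < t" "t < x" for t
            using r_at[of t] W_le[of t] pos[of "- t"] that y s
            by (intro exI[of _ "W t / (u t)\<^sup>2"]) (auto simp: divide_nonpos_nonneg)
        qed (use y in auto)
        then show "r (- (- x)) - 1 \<le> r (- y) - 1" by simp
      qed (use s zx r_gt[OF ax] in auto)
      then show ?thesis by simp
    qed
    have gt: "1 < r t" if "a < t" "t \<le> x" for t
      using r_ge[OF that] r_gt[OF ax] zx by linarith
    have "0 \<le> W a"
    proof (cases "a = 0")
      case True
      then show ?thesis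
        using u za \<open>0 < u' 0\<close> by (auto simp: W_def trajectory_def mult_nonpos_nonneg)
    next
      case False
      then have ua: "0 < u a"
        using a u_pos by auto
      have "u t \<noteq> 0" if "a \<le> t" for t
        using u_pos[of t] that a False by auto
      then have "continuous_on {a..x} r"
        unfolding r_def
        by (intro continuous_intros continuous_on_subset[OF cont_z(1)] continuous_on_subset[OF cont_u(1)]) auto
      then have "(r \<longlongrightarrow> r a) (at_right a)"
        using ax by (simp add: continuous_on_Icc_at_rightD)
      moreover have "eventually (\<lambda>t. r x \<le> r t) (at_right a)"
        using r_ge ax by (auto simp: eventually_at_right_field intro!: exI[of _ x])
      ultimately have "r x \<le> r a"
        by (intro tendsto_lowerbound) auto
      moreover have "r a \<le> 1"
        using za ua by (simp add: r_def)
      ultimately show ?thesis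
        using r_gt[OF ax] zx by linarith
    qed
    also have "W a < W x"
      using ax gt by (intro W_mono) auto
    finally show False
      using W_le[OF ax] gt[OF ax] by simp
  qed
  have r_ge: "r c \<le> r y" if y: "c \<le> y" for y
  proof -
    have "r c - 1 \<le> r y - 1"
    proof (rule positive_persists[where D = "\<lambda>t. r t - 1" and c = c and d = y])
      show "continuous_on {c..y} (\<lambda>t. r t - 1)"
        by (intro continuous_intros cont_r c)
      fix s assume s: "c < s" "s \<le> y" and pos: "\<And>t. \<lbrakk>c \<le> t; t < s\<rbrakk> \<Longrightarrow> 0 < r t - 1"
      have "r c \<le> r s"
      proof (rule DERIV_nonneg_imp_increasing_open[where a = c and b = s and f = r])
        show "continuous_on {c..s} r"
          by (intro cont_r c)
        fix t assume t: "c < t" "t < s"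
        have "W c < W t"
          using c t pos by (intro W_mono) auto
        then show "\<exists>d. (r has_real_derivative d) (at t) \<and> 0 \<le> d"
          using r_at[of t] c t by (intro exI[of _ "W t / (u t)\<^sup>2"]) auto
      qed (use s in auto)
      then show "r c - 1 \<le> r s - 1" by simp
    qed (use c y in auto)
    then show ?thesis by simp
  qed
  define k where "k = r c"
  have k: "1 < k" using c by (simp add: k_def)
  then have kp: "1 < k powr p"
    using p by (simp add: gr_one_powr)
  have u_small: "k powr p * u y powr p \<le> y" if "c \<le> y" for y
  proof -
    have "0 < u y" using that a c u_pos by auto
    then have "k * u y \<le> z y"
      using r_ge[OF that] by (simp add: k_def r_def field_simps)
    also have "\<dots> \<le> y powr (1 / p)"
      using that c by (intro z_le) auto
    finally have "(k * u y) powr p \<le> y"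
      using p k \<open>0 < u y\<close> that a c by (subst le_powr_inverse_iff[symmetric]) auto
    then show ?thesis
      using k \<open>0 < u y\<close> by (simp add: powr_mult)
  qed
  \<comment> \<open>Growth on \<open>[y - 1, y]\<close> gives \<open>y - 2 \<le> u y powr p\<close>
    once \<open>y \<ge> 2\<close>, so \<open>k powr p * (y - 2) \<le> y\<close>. This fails for
    \<open>y\<close> beyond \<open>2 * k powr p / (k powr p - 1)\<close>.\<close>
  define y where "y = max (max c 2) (2 * k powr p / (k powr p - 1) + 1)"
  have y: "c \<le> y" "2 \<le> y" "2 * k powr p / (k powr p - 1) < y"
    by (auto simp: y_def)
  have "y - 1 - 1 / ((y - 1) * (y - (y - 1))) \<le> u y powr p"
    using y u'_nonneg by (intro trajectory_growth[OF p u \<open>0 < u' 0\<close>]) auto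
  moreover have "1 / ((y - 1) * (y - (y - 1))) \<le> 1"
    using y by simp
  ultimately have "y - 2 \<le> u y powr p"
    by linarith
  then have "k powr p * (y - 2) \<le> k powr p * u y powr p"
    using kp by (intro mult_left_mono) auto
  also have "\<dots> \<le> y"
    by (rule u_small[OF y(1)])
  finally show False
    using y(3) kp by (simp add: field_simps)
qed

section \<open>The shooting argument\<close>

text \<open>Above the curve \<open>x powr (1 / p)\<close> the trajectory is a straight line, and it crosses the curve
  with a slope that exceeds all later slopes of the curve, so it never comes back.\<close>
lemma trajectory_crossing:
  assumes p: "p > 1" and u: "trajectory p u u'" and x: "0 \<le> x" "x powr (1 / p) < u x" and y: "0 \<le> y"
  shows "0 \<le> u' y"
proof -
  define D where "D = (\<lambda>t. u t - t powr (1 / p))"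
  have cont_D: "continuous_on {a..b} D" if "0 \<le> a" for a b
    unfolding D_def using p that
    by (intro continuous_intros continuous_on_powr' continuous_on_subset[OF trajectory_continuous(1)[OF u]]) auto
  have D_at: "(D has_real_derivative u' t - 1 / p * t powr (1 / p - 1)) (at t)" if "0 < t" for t
    unfolding D_def using that
    by (auto intro!: derivative_eq_intros trajectory_derivs_at[OF u])
  let ?S = "{t \<in> {0..x}. D t \<le> 0}"
  have "closed ?S"
    by (intro continuous_on_closed_Collect_le cont_D continuous_intros) auto
  then have "compact ?S"
    by (intro compact_eq_bounded_closed[THEN iffD2] conjI bounded_subset[OF bounded_closed_interval]) auto
  moreover have "0 \<in> ?S"
    using x u by (simp add: D_def trajectory_def)
  \<comment> \<open>The last point of \<open>[0, x]\<close> at or below the curve. Between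
    \<open>m\<close> and \<open>x\<close> the trajectory is above it, and the mean value theorem
    finds there a point \<open>\<xi>\<close> where \<open>u\<close> is steeper than the
    curve.\<close>
  ultimately obtain m where m: "m \<in> ?S" "\<And>t. t \<in> ?S \<Longrightarrow> t \<le> m"
    using compact_attains_sup[of ?S] by blast
  have "0 < D x"
    using x by (simp add: D_def)
  then have "m < x"
    using m(1) by (cases "m = x") auto
  moreover have "continuous_on {m..x} D"
    using m by (intro cont_D) auto
  ultimately obtain \<xi> where \<xi>: "m < \<xi>" "\<xi> < x" "D x - D m = (x - m) * (u' \<xi> - 1 / p * \<xi> powr (1 / p - 1))"
    using mean_value[of m x D "\<lambda>t. u' t - 1 / p * t powr (1 / p - 1)"] D_at m(1) by auto
  then have "0 < \<xi>" using m(1) by auto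
  have "0 < (x - m) * (u' \<xi> - 1 / p * \<xi> powr (1 / p - 1))"
    using \<xi>(3) m(1) \<open>0 < D x\<close> by auto
  then have slope: "1 / p * \<xi> powr (1 / p - 1) < u' \<xi>"
    using \<open>m < x\<close> by (simp add: zero_less_mult_iff)
  have "0 < D \<xi>"
    using m(2)[of \<xi>] m(1) \<xi> by fastforce
  have const: "u' t = u' \<xi>" if t: "\<xi> < t" and pos: "\<And>s. \<lbrakk>\<xi> \<le> s; s < t\<rbrakk> \<Longrightarrow> 0 < D s" for t
  proof -
    obtain c where c: "\<xi> < c" "c < t" "u' t - u' \<xi> = (t - \<xi>) * - damping p c (u c)"
      using trajectory_mean_value'[OF u less_imp_le[OF \<open>0 < \<xi>\<close>] t] by blast
    have "damping p c (u c) = 0"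
      using pos[of c] c \<open>0 < \<xi>\<close> by (intro damping_above p) (auto simp: D_def)
    with c show ?thesis by simp
  qed
  have D_pos: "0 < D t" if t: "\<xi> \<le> t" for t
  proof -
    have "D \<xi> \<le> D t"
    proof (rule positive_persists[where D = D and c = \<xi> and d = t])
      show "continuous_on {\<xi>..t} D"
        using \<open>0 < \<xi>\<close> by (intro cont_D) auto
      fix s assume s: "\<xi> < s" "s \<le> t" and pos: "\<And>t. \<lbrakk>\<xi> \<le> t; t < s\<rbrakk> \<Longrightarrow> 0 < D t"
      show "D \<xi> \<le> D s"
      proof (rule DERIV_nonneg_imp_increasing_open[where a = \<xi> and b = s and f = D])
        show "continuous_on {\<xi>..s} D"
          using \<open>0 < \<xi>\<close> by (intro cont_D) auto
        fix r assume r: "\<xi> < r" "r < s"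
        have "r powr (1 / p - 1) \<le> \<xi> powr (1 / p - 1)"
          using p r \<open>0 < \<xi>\<close> by (intro powr_mono2') auto
        then have "1 / p * r powr (1 / p - 1) \<le> 1 / p * \<xi> powr (1 / p - 1)"
          using p by (intro mult_left_mono) auto
        moreover have "u' r = u' \<xi>"
          using r pos by (intro const) auto
        ultimately have "0 \<le> u' r - 1 / p * r powr (1 / p - 1)"
          using slope by linarith
        then show "\<exists>d. (D has_real_derivative d) (at r) \<and> 0 \<le> d"
          using D_at[of r] r \<open>0 < \<xi>\<close> by auto
      qed (use s in auto)
    qed (use t \<open>0 < D \<xi>\<close> in auto)
    with \<open>0 < D \<xi>\<close> show ?thesis by linarith
  qed
  have "0 \<le> 1 / p * \<xi> powr (1 / p - 1)"
    using p by simp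
  then have "0 \<le> u' \<xi>"
    using slope by linarith
  show ?thesis
  proof (cases "y \<le> \<xi>")
    case True
    then show ?thesis
      using trajectory_concave[OF p u y, of \<xi>] \<open>0 \<le> u' \<xi>\<close> by linarith
  next
    case False
    then show ?thesis
      using const[of y] D_pos \<open>0 \<le> u' \<xi>\<close> by auto
  qed
qed

lemma shooting:
  assumes p: "p > 1"
  obtains u u' where "trajectory p u u'" "0 < u' 0"
    "\<And>x. 0 \<le> x \<Longrightarrow> 0 \<le> u' x" "\<And>x. 0 \<le> x \<Longrightarrow> u x \<le> x powr (1 / p)"
proof -
  obtain U U' where U: "\<And>a. trajectory p (U a) (U' a)" and U'0: "\<And>a. U' a 0 = a"
    and lip: "\<And>a b x. 0 \<le> x \<Longrightarrow> \<bar>U a x - U b x\<bar> \<le> 2 * exp (p * x\<^sup>2) * \<bar>a - b\<bar>"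
    using trajectory_exists[OF p] by blast
  have cont: "continuous_on UNIV (\<lambda>a. U a x)" if "0 \<le> x" for x
    using lip[OF that]
    by (intro lipschitz_on_continuous_on[of "2 * exp (p * x\<^sup>2)"] lipschitz_onI) (auto simp: dist_real_def)
  \<comment> \<open>Decrease is expressed by two values rather than by a negative slope, so
    continuity of \<open>U a x\<close> in \<open>a\<close> already makes \<open>A\<close>
    open.\<close>
  define A where "A = (\<Union>x\<in>{0..}. \<Union>y\<in>{x<..}. {a. U a y < U a x})"
  define B where "B = (\<Union>x\<in>{0..}. {a. x powr (1 / p) < U a x})"
  have "open A"
    unfolding A_def by (intro open_UN ballI open_Collect_less cont) auto
  have "open B"
    unfolding B_def by (intro open_UN ballI open_Collect_less cont continuous_intros) auto
  have slope_nonneg: "0 \<le> U' a x" if "a \<notin> A" "0 \<le> x" for a x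
  proof (rule ccontr)
    assume "\<not> 0 \<le> U' a x"
    then have "U a (x + 1) < U a x"
      using trajectory_increment(2)[OF p U that(2), of "x + 1" a] by simp
    then have "a \<in> A"
      unfolding A_def using that(2) by (intro UN_I[of x] UN_I[of "x + 1"]) auto
    with that show False by simp
  qed
  \<comment> \<open>Having exceeded the curve somewhere forces a nonnegative slope everywhere, which
    rules out any decrease.\<close>
  have "A \<inter> B = {}"
  proof (rule ccontr)
    assume "A \<inter> B \<noteq> {}"
    then obtain a x y z where *: "0 \<le> x" "x < y" "U a y < U a x" "0 \<le> z" "z powr (1 / p) < U a z"
      by (auto simp: A_def B_def)
    have "0 \<le> U' a y"
      using * by (intro trajectory_crossing[OF p U]) auto
    then show False
      using trajectory_mono[OF p U, of x y a] * by auto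
  qed
  \<comment> \<open>If this trajectory never decreased, growth on \<open>[2, 3]\<close> would give
    \<open>U (1/3) 3 powr p \<ge> 3 / 2\<close>, whereas concavity gives
    \<open>U (1/3) 3 \<le> 3 * (1 / 3) = 1\<close>.\<close>
  have "1 / 3 \<in> A"
  proof (rule ccontr)
    assume "1 / 3 \<notin> A"
    then have nonneg: "0 \<le> U' (1/3) 3"
      by (intro slope_nonneg) auto
    then have "2 - 1 / (2 * (3 - 2)) \<le> U (1/3) 3 powr p"
      by (intro trajectory_growth[OF p U]) (auto simp: U'0)
    moreover have "U (1/3) 3 \<le> 1"
      using trajectory_increment(2)[OF p U, of 0 3 "1/3"] U[of "1/3"] by (simp add: U'0 trajectory_def)
    moreover have "0 < U (1/3) 3"
      using nonneg by (intro trajectory_pos[OF p U]) (auto simp: U'0)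
    ultimately show False
      using p powr_mono2[of p "U (1/3) 3" 1] by simp
  qed
  \<comment> \<open>On \<open>[0, 1]\<close> the damping is at most \<open>1\<close>, so the slope
    at \<open>1\<close> is at least \<open>2\<close>; by concavity \<open>U 3 1 \<ge> 2\<close>,
    above the height \<open>1\<close> of the curve.\<close>
  have "3 \<in> B"
  proof -
    obtain c where c: "0 < c" "c < 1" "U' 3 1 - U' 3 0 = (1 - 0) * - damping p c (U 3 c)"
      using trajectory_mean_value'[OF U, of 0 1 3] by auto
    have "clip p c (U 3 c) \<le> 1"
      using clip_le[of p c "U 3 c"] powr_mono2[of "1/p" c 1] c p by simp
    moreover have "c - clip p c (U 3 c) powr p \<le> 1"
      using c powr_ge_zero[of "clip p c (U 3 c)" p] by linarith
    ultimately have "damping p c (U 3 c) \<le> 1"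
      unfolding damping_def using clip_nonneg[of p c "U 3 c"] mult_left_le order_trans by blast
    then have "2 \<le> U' 3 1"
      using c by (simp add: U'0)
    then have "1 powr (1 / p) < U 3 1"
      using trajectory_increment(1)[OF p U, of 0 1 3] U[of 3] by (simp add: trajectory_def)
    then show ?thesis
      unfolding B_def by (intro UN_I[of 1]) auto
  qed
  have "\<not> {1/3..3} \<subseteq> A \<union> B"
  proof
    assume "{1/3..3} \<subseteq> A \<union> B"
    then have "A \<inter> {1/3..3} = {} \<or> B \<inter> {1/3..3} = {}"
      using \<open>A \<inter> B = {}\<close> by (intro connectedD[OF connected_Icc \<open>open A\<close> \<open>open B\<close>]) auto
    then show False
      using \<open>1 / 3 \<in> A\<close> \<open>3 \<in> B\<close> by (auto simp: disjoint_iff)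
  qed
  then obtain a where "a \<in> {1/3..3}" "a \<notin> A \<union> B"
    by blast
  then have a: "0 < a" "a \<notin> A" "a \<notin> B"
    by auto
  show thesis
  proof (rule that[of "U a" "U' a"])
    show "U a x \<le> x powr (1 / p)" if "0 \<le> x" for x
      using a that by (auto simp: B_def not_less)
  qed (use a U slope_nonneg U'0 in auto)
qed

section \<open>Solutions and trajectories correspond\<close>

text \<open>The bounds keep \<open>u\<close> in the strip where clipping is inactive, so there the
  damping is the original nonlinearity.\<close>

lemma trajectory_solution:
  assumes p: "p > 1" and u: "trajectory p u u'" and "0 < u' 0"
    and nonneg: "\<And>x. 0 \<le> x \<Longrightarrow> 0 \<le> u' x" and le: "\<And>x. 0 \<le> x \<Longrightarrow> u x \<le> x powr (1 / p)"
  shows "is_nontrivial_solution p u"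
proof -
  have u0: "u 0 = 0"
    using u by (simp add: trajectory_def)
  have pos: "0 < u x" if "0 < x" for x
    using that assms by (intro trajectory_pos[OF p u]) auto
  have u_nonneg: "0 \<le> u x" if "0 \<le> x" for x
    using pos[of x] that u0 by (cases "x = 0") auto
  have "u field_differentiable (at x) \<and> deriv u field_differentiable (at x) \<and>
      - deriv (deriv u) x = x * u x - u x powr (p + 1)" if x: "0 < x" for x
  proof -
    have "eventually (\<lambda>y. y \<in> {0<..}) (nhds x)"
      using x by (intro eventually_nhds_in_open) auto
    then have "eventually (\<lambda>y. deriv u y = u' y) (nhds x)"
      by eventually_elim (auto intro: DERIV_imp_deriv trajectory_derivs_at[OF u])
    then have "(deriv u has_real_derivative - damping p x (u x)) (at x)"
      using trajectory_derivs_at(2)[OF u x] by (simp add: DERIV_cong_ev)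
    moreover have "damping p x (u x) = x * u x - u x powr (p + 1)"
      using damping_eq[of "u x" x p] pos[OF x] le[of x] x by (simp add: powr_add algebra_simps)
    ultimately have "(deriv u has_real_derivative - (x * u x - u x powr (p + 1))) (at x)"
      by simp
    then show ?thesis
      using trajectory_derivs_at(1)[OF u x] DERIV_imp_deriv[of "deriv u"]
      unfolding field_differentiable_def by force
  qed
  then have "is_solution p u"
    using trajectory_continuous(1)[OF u] u0 u_nonneg le by (simp add: is_solution_def)
  moreover have "\<exists>x\<ge>0. u x \<noteq> 0"
    using pos[of 1] by (intro exI[of _ 1]) auto
  ultimately show ?thesis
    by (simp add: is_nontrivial_solution_def)
qed

text \<open>A solution is not assumed differentiable at \<open>0\<close>, but its second derivative
  \<open>- G\<close> extends continuously to \<open>0\<close>; integrating it twice recovers the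
  one-sided derivatives there. A negative slope would drive the concave \<open>v\<close> below zero,
  and a nonpositive initial slope would make it vanish identically.\<close>

lemma solution_trajectory:
  assumes p: "p > 1" and v: "is_nontrivial_solution p v"
  obtains v' where "trajectory p v v'" "0 < v' 0" "\<And>x. 0 \<le> x \<Longrightarrow> 0 \<le> v' x"
proof -
  have cont_v: "continuous_on {0..} v" and v0: "v 0 = 0"
    and v_bounds: "\<And>x. 0 \<le> x \<Longrightarrow> 0 \<le> v x \<and> v x \<le> x powr (1 / p)"
    and v_ode: "\<And>x. 0 < x \<Longrightarrow> v field_differentiable (at x) \<and> deriv v field_differentiable (at x) \<and>
        - deriv (deriv v) x = x * v x - v x powr (p + 1)"
    using v by (auto simp: is_nontrivial_solution_def is_solution_def)
  define G where "G = (\<lambda>t. damping p t (v t))"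
  have cont_G: "continuous_on {0..} G"
    unfolding G_def by (intro continuous_on_damping p cont_v) auto
  have v_at: "(v has_real_derivative deriv v x) (at x)" if "0 < x" for x
    using v_ode[OF that] by (simp add: DERIV_deriv_iff_field_differentiable)
  have v'_at: "(deriv v has_real_derivative - G x) (at x)" if "0 < x" for x
  proof -
    have "(deriv v has_real_derivative deriv (deriv v) x) (at x)"
      using v_ode[OF that] by (simp add: DERIV_deriv_iff_field_differentiable)
    moreover have "v x * v x powr p = v x powr (p + 1)"
      using v_bounds[of x] that by (cases "v x = 0") (auto simp: powr_add)
    then have "G x = - deriv (deriv v) x"
      using damping_eq[of "v x" x p] v_bounds[of x] v_ode[OF that] that
      by (simp add: G_def algebra_simps)
    ultimately show ?thesis by simp
  qed
  define H where "H = (\<lambda>x. integral {0..x} G)"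
  have H_deriv: "(H has_real_derivative G x) (at x within {0..})" if "0 \<le> x" for x
    unfolding H_def by (intro has_derivative_integral_half_line cont_G that)
  have H_at: "(H has_real_derivative G x) (at x)" if "0 < x" for x
    using H_deriv[of x] that by (simp add: at_within_half_line)
  \<comment> \<open>The constant of integration is fixed at the interior point \<open>1\<close>,
    since the slope at \<open>0\<close> is not yet available.\<close>
  define v' where "v' = (\<lambda>x. deriv v 1 + H 1 - H x)"
  have v'_deriv: "(v' has_real_derivative - G x) (at x within {0..})" if "0 \<le> x" for x
    unfolding v'_def using that by (auto intro!: derivative_eq_intros H_deriv)
  have v'_eq: "deriv v x = v' x" if "0 < x" for x
  proof -
    have "((\<lambda>x. deriv v x + H x) has_real_derivative 0) (at y)" if "0 < y" for y
      using DERIV_add[OF v'_at[OF that] H_at[OF that]] by simp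
    then have "\<exists>c. \<forall>y\<in>{0<..}. deriv v y + H y = c"
      by (intro has_field_derivative_zero_constant) (auto simp: at_within_open[of _ "{0<..}"])
    then have "deriv v x + H x = deriv v 1 + H 1"
      using that by auto
    then show ?thesis by (simp add: v'_def)
  qed
  have cont_v': "continuous_on {0..} v'"
    using v'_deriv by (intro DERIV_continuous_on) auto
  define K where "K = (\<lambda>x. integral {0..x} v')"
  have K_deriv: "(K has_real_derivative v' x) (at x within {0..})" if "0 \<le> x" for x
    unfolding K_def by (intro has_derivative_integral_half_line cont_v' that)
  have K_at: "(K has_real_derivative v' x) (at x)" if "0 < x" for x
    using K_deriv[of x] that by (simp add: at_within_half_line)
  have cont_K: "continuous_on {0..} K"
    unfolding K_def by (intro continuous_on_integral_half_line cont_v')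
  have v_eq: "v x = K x" if "0 \<le> x" for x
  proof (cases "x = 0")
    case True
    then show ?thesis by (simp add: v0 K_def)
  next
    case False
    then have "0 < x" using that by simp
    have cont: "continuous_on {0..x} (\<lambda>t. v t - K t)"
      by (intro continuous_intros continuous_on_subset[OF cont_v] continuous_on_subset[OF cont_K]) auto
    have "((\<lambda>t. v t - K t) has_real_derivative 0) (at t)" if "0 < t" for t
      using DERIV_diff[OF v_at[OF that] K_at[OF that]] v'_eq[OF that] by simp
    then have "(v x - K x) - (v 0 - K 0) = (x - 0) * 0"
      using mean_value[OF \<open>0 < x\<close> cont, of "\<lambda>_. 0"] by blast
    then show ?thesis by (simp add: v0 K_def)
  qed
  have traj: "trajectory p v v'"
    unfolding trajectory_def
  proof (intro conjI allI impI)
    fix x :: real assume x: "0 \<le> x"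
    show "(v has_real_derivative v' x) (at x within {0..})"
      by (rule has_field_derivative_transform_within[OF K_deriv[OF x] zero_less_one]) (use x v_eq in auto)
    show "(v' has_real_derivative - damping p x (v x)) (at x within {0..})"
      using v'_deriv[OF x] by (simp add: G_def)
  qed (rule v0)
  moreover have "0 \<le> v' x" if x: "0 \<le> x" for x
  proof (rule ccontr)
    assume neg: "\<not> 0 \<le> v' x"
    \<comment> \<open>The point at which the tangent at \<open>x\<close> has descended to the height
      \<open>- 1\<close>; the concave \<open>v\<close> lies below its tangent.\<close>
    define y where "y = x + (v x + 1) / - v' x"
    have "x \<le> y" "(y - x) * v' x = - (v x + 1)"
      using neg v_bounds[OF x] by (auto simp: y_def divide_nonneg_neg field_simps)
    then have "v y \<le> - 1"
      using trajectory_increment(2)[OF p traj x] by fastforce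
    then show False
      using v_bounds[of y] x \<open>x \<le> y\<close> by auto
  qed
  moreover have "0 < v' 0"
  proof (rule ccontr)
    assume neg: "\<not> 0 < v' 0"
    have "v x = 0" if "0 \<le> x" for x
    proof -
      have "v x \<le> x * v' 0"
        using trajectory_increment(2)[OF p traj, of 0 x] that v0 by simp
      also have "\<dots> \<le> 0"
        using neg that by (simp add: mult_nonneg_nonpos)
      finally show ?thesis
        using v_bounds[OF that] by simp
    qed
    then show False
      using v by (auto simp: is_nontrivial_solution_def)
  qed
  ultimately show thesis
    using that by blast
qed

section \<open>Strict monotonicity and behaviour at infinity\<close>

text \<open>A slope that vanishes once vanishes from there on by concavity, so the damping vanishes
  too and the positive \<open>u\<close> meets the curve arbitrarily far out. A constant cannot meet
  the strictly increasing curve at two points.\<close>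

lemma trajectory_strict_slope:
  assumes p: "p > 1" and u: "trajectory p u u'" and "0 < u' 0"
    and nonneg: "\<And>x. 0 \<le> x \<Longrightarrow> 0 \<le> u' x" and le: "\<And>x. 0 \<le> x \<Longrightarrow> u x \<le> x powr (1 / p)"
    and x: "0 \<le> x"
  shows "0 < u' x"
proof (rule ccontr)
  assume "\<not> 0 < u' x"
  then have flat: "u' y = 0" if "x \<le> y" for y
    using trajectory_concave[OF p u x that] nonneg[of y] x that by auto
  have on_curve: "\<exists>c. y < c \<and> c < y + 1 \<and> u c powr p = c" if y: "x \<le> y" for y
  proof -
    obtain c where c: "y < c" "c < y + 1" "u' (y + 1) - u' y = (y + 1 - y) * - damping p c (u c)"
      using trajectory_mean_value'[OF u order_trans[OF x y] less_add_one] by blast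
    then have "damping p c (u c) = 0"
      using flat y by simp
    moreover have "0 < u c"
      using c x y nonneg by (intro trajectory_pos[OF p u \<open>0 < u' 0\<close>]) auto
    ultimately show ?thesis
      using damping_eq[of "u c" c p] le[of c] c x y by auto
  qed
  obtain c where c: "x < c" "c < x + 1" "u c powr p = c"
    using on_curve[of x] by auto
  obtain d where d: "x + 1 < d" "u d powr p = d"
    using on_curve[of "x + 1"] by auto
  have "u d \<le> u c"
    using trajectory_increment(2)[OF p u, of c d] flat[of c] c d x by auto
  moreover have "0 \<le> u d"
    using trajectory_mono[OF p u, of 0 d] nonneg d x u by (auto simp: trajectory_def)
  ultimately have "u d powr p \<le> u c powr p"
    using p by (intro powr_mono2) auto
  with c d show False by simp
qed

text \<open>The exponent \<open>1 / p - 3\<close> balances the equation: the curve bends like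
  \<open>x powr (1 / p - 2)\<close>, and a relative deficit of order \<open>1 / x ^ 3\<close>
  changes the nonlinearity by the same order. The constant \<open>32\<close> leaves room for a
  subsolution on \<open>[4, \<infinity>)\<close>.\<close>

lemma trajectory_lower_bound:
  assumes p: "p > 1" and u: "trajectory p u u'" and u'0: "0 < u' 0"
    and nonneg: "\<And>x. 0 \<le> x \<Longrightarrow> 0 \<le> u' x" and le: "\<And>x. 0 \<le> x \<Longrightarrow> u x \<le> x powr (1 / p)"
    and x: "4 \<le> x"
  shows "x powr (1 / p) - 32 * x powr (1 / p - 3) \<le> u x"
proof -
  define q where "q = 1 / p"
  have q: "0 < q" "q < 1"
    using p by (auto simp: q_def)
  define z where "z = (\<lambda>x. x powr q - 32 * x powr (q - 3))"
  define z' where "z' = (\<lambda>x. q * x powr (q - 1) - 32 * ((q - 3) * x powr (q - 4)))"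
  define z'' where "z'' = (\<lambda>x. q * ((q - 1) * x powr (q - 2)) - 32 * ((q - 3) * ((q - 4) * x powr (q - 5))))"
  have z_eq: "z x = x powr q * (1 - 32 / x ^ 3)" if "0 < x" for x
    using that by (simp add: z_def powr_diff algebra_simps)
  have "z x \<le> u x"
  proof (rule trajectory_comparison[OF p u u'0 nonneg le, where a = 4])
    fix x :: real assume x: "4 \<le> x"
    show "(z has_real_derivative z' x) (at x within {4..})"
      unfolding z_def z'_def using x
      by (auto intro!: derivative_eq_intros has_field_derivative_powr[THEN has_field_derivative_at_within])
    show "(z' has_real_derivative z'' x) (at x within {4..})"
      unfolding z'_def z''_def using x by (auto intro!: derivative_eq_intros)
    show "z x \<le> x powr (1 / p)"
      by (simp add: z_def q_def)
  next
    fix x :: real assume x: "4 < x" "u x < z x"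
    \<comment> \<open>The relative deficit of \<open>z\<close> below the curve. As
      \<open>32 = 4 ^ 3 / 2\<close>, it is at most \<open>1 / 2\<close> from \<open>4\<close>
      on.\<close>
    define s where "s = 32 / x ^ 3"
    define X where "X = x powr q"
    have "4 ^ 3 \<le> x ^ 3"
      using x by (intro power_mono) auto
    then have s: "0 < s" "s \<le> 1 / 2"
      using x by (auto simp: s_def field_simps)
    have "0 < X"
      using x by (simp add: X_def)
    have z_s: "z x = X * (1 - s)"
      using z_eq[of x] x by (simp add: X_def s_def)
    have "(1 - s) powr p \<le> (1 - s) powr 1"
      using s p by (intro powr_mono') auto
    then have "x * (1 - s) powr p \<le> x * (1 - s)"
      using s x by (intro mult_left_mono) auto
    moreover have "z x powr p = x * (1 - s) powr p"
      using s x p \<open>0 < X\<close> by (simp add: z_s powr_mult X_def powr_powr q_def)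
    ultimately have "x * s \<le> x - z x powr p"
      by (simp add: algebra_simps)
    then have "X * (1 - s) * (x * s) \<le> z x * (x - z x powr p)"
      unfolding z_s using s \<open>0 < X\<close> by (intro mult_left_mono) auto
    moreover have "X * (1 - s) * (x * s) = X / x\<^sup>2 * (32 * (1 - s))"
      using x by (simp add: s_def field_simps power2_eq_square power3_eq_cube)
    moreover have "z'' x = - (X / x\<^sup>2 * (q * (1 - q) + (3 - q) * (4 - q) * s))"
      using x by (simp add: z''_def s_def X_def powr_diff field_simps eval_nat_numeral)
    \<comment> \<open>The left side is at most \<open>1 + 6 = 7\<close>, the right side at least
      \<open>16\<close>.\<close>
    moreover have "q * (1 - q) + (3 - q) * (4 - q) * s \<le> 32 * (1 - s)"
    proof -
      have "q * (1 - q) \<le> 1 * 1"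
        using q by (intro mult_mono) auto
      moreover have "(3 - q) * (4 - q) * s \<le> (3 * 4) * (1 / 2)"
        using q s by (intro mult_mono) auto
      ultimately have "q * (1 - q) + (3 - q) * (4 - q) * s \<le> 1 * 1 + (3 * 4) * (1 / 2)"
        by (rule add_mono)
      also have "\<dots> \<le> 32 * (1 - s)"
        using s by simp
      finally show ?thesis .
    qed
    then have "X / x\<^sup>2 * (q * (1 - q) + (3 - q) * (4 - q) * s) \<le> X / x\<^sup>2 * (32 * (1 - s))"
      using \<open>0 < X\<close> by (intro mult_left_mono) auto
    ultimately show "- (z x * (x - z x powr p)) \<le> z'' x"
      by linarith
  next
    \<comment> \<open>At \<open>4\<close> the deficit is exactly \<open>1 / 2\<close>, hence
      \<open>z 4 powr p = 4 * (1 / 2) powr p \<le> 2\<close>, while growth on \<open>[3, 4]\<close>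
      gives \<open>u 4 powr p \<ge> 8 / 3\<close>.\<close>
    show "z 4 \<le> u 4"
    proof (rule ccontr)
      assume "\<not> z 4 \<le> u 4"
      moreover have "0 < u 4"
        using nonneg by (intro trajectory_pos[OF p u u'0]) auto
      ultimately have "u 4 powr p \<le> z 4 powr p"
        using p by (intro powr_mono2) auto
      also have "z 4 powr p = 4 * (1 / 2) powr p"
      proof -
        have "z 4 = 4 powr (1 / p) * (1 / 2)"
          using z_eq[of 4] by (simp add: q_def)
        then have "z 4 powr p = (4 powr (1 / p)) powr p * (1 / 2) powr p"
          by (simp only: powr_mult)
        then show ?thesis
          using p by (simp add: powr_powr)
      qed
      also have "(1 / 2 :: real) powr p \<le> (1 / 2) powr 1"
        using p by (intro powr_mono') auto
      finally have "u 4 powr p \<le> 2" by simp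
      moreover have "3 - 1 / (3 * (4 - 3)) \<le> u 4 powr p"
        using nonneg by (intro trajectory_growth[OF p u u'0]) auto
      ultimately show False by simp
    qed
  qed (use x in auto)
  then show ?thesis by (simp add: z_def q_def)
qed

theorem propositionB2:
  fixes p :: real
  assumes "p > 1"
  shows "\<exists>U. is_nontrivial_solution p U \<and>
             (\<forall>v. is_nontrivial_solution p v \<longrightarrow> (\<forall>x\<ge>0. v x = U x)) \<and>
             (\<forall>x\<ge>0. \<exists>d>0. (U has_real_derivative d) (at x within {0..})) \<and>
             (\<lambda>x. U x - x powr (1 / p)) \<in> O[at_top](\<lambda>x. x powr ((1 - 3 * p) / p))"
proof -
  note p = \<open>p > 1\<close>
  obtain U U' where U: "trajectory p U U'" "0 < U' 0"
    "\<And>x. 0 \<le> x \<Longrightarrow> 0 \<le> U' x" "\<And>x. 0 \<le> x \<Longrightarrow> U x \<le> x powr (1 / p)"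
    using shooting[OF p] by blast
  \<comment> \<open>A solution can play both roles in the comparison, that of the trajectory and
    that of the subsolution on \<open>[0, \<infinity>)\<close>. Exchanging \<open>v\<close> and
    \<open>w\<close> then yields uniqueness.\<close>
  have le: "w x \<le> v x" if v: "is_nontrivial_solution p v" and w: "is_nontrivial_solution p w" and x: "0 \<le> x" for v w x
  proof -
    have bounds: "0 \<le> u x" "u x \<le> x powr (1 / p)" if "is_nontrivial_solution p u" "0 \<le> x" for u x
      using that by (auto simp: is_nontrivial_solution_def is_solution_def)
    obtain v' where v': "trajectory p v v'" "0 < v' 0" "\<And>x. 0 \<le> x \<Longrightarrow> 0 \<le> v' x"
      using solution_trajectory[OF p v] by blast
    obtain w' where w': "trajectory p w w'"
      using solution_trajectory[OF p w] by blast
    show ?thesis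
    proof (rule trajectory_comparison[OF p v' bounds(2)[OF v] order_refl trajectory_derivs[OF w'] bounds(2)[OF w]])
      show "- (w x * (x - w x powr p)) \<le> - damping p x (w x)" if "0 < x" for x
        using damping_eq bounds[OF w, of x] that by simp
      show "w 0 \<le> v 0"
        using v' w' by (simp add: trajectory_def)
    qed (use x in auto)
  qed
  have sol: "is_nontrivial_solution p U"
    using U by (rule trajectory_solution[OF p])
  moreover have "\<forall>v. is_nontrivial_solution p v \<longrightarrow> (\<forall>x\<ge>0. v x = U x)"
    using le sol by (auto intro!: antisym)
  moreover have "\<forall>x\<ge>0. \<exists>d>0. (U has_real_derivative d) (at x within {0..})"
    using trajectory_derivs(1)[OF U(1)] trajectory_strict_slope[OF p U] by blast
  moreover have "(\<lambda>x. U x - x powr (1 / p)) \<in> O[at_top](\<lambda>x. x powr ((1 - 3 * p) / p))"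
  \<comment> \<open>Since \<open>U\<close> stays below the curve, the norm is the deficit itself,
    and the constant is that of the subsolution.\<close>
  proof (rule bigoI[where c = 32])
    have "norm (U x - x powr (1 / p)) \<le> 32 * norm (x powr ((1 - 3 * p) / p))" if "4 \<le> x" for x
    proof -
      have "(1 - 3 * p) / p = 1 / p - 3"
        using p by (simp add: field_simps)
      then show ?thesis
        using trajectory_lower_bound[OF p U that] U(4)[of x] that by simp
    qed
    then show "eventually (\<lambda>x. norm (U x - x powr (1 / p)) \<le> 32 * norm (x powr ((1 - 3 * p) / p))) at_top"
      by (auto simp: eventually_at_top_linorder)
  qed
  ultimately show ?thesis by blast
qed

end
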